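(* Consider a tokenizer with character alphabet $\Sigma$ and token ID alphabet $\mathbb{N}=\{0,1,\dots,|V|-1\}$, and let $L\subseteq\Sigma^*$. If $L$ is a context-free language over $\Sigma$, then the extended tokenization language $L'_E\subseteq\mathbb{N}^*$ of $L$ is a context-free language over $\mathbb{N}$.
   Context: Here $\mathbb{N}$ does not denote the natural numbers. A tokenizer has a finite character alphabet $\Sigma$ and a finite vocabulary $V$ of tokens, which are strings over $\Sigma$, indexed by the token IDs in the finite alphabet $\mathbb{N}=\{0,1,\dots,|V|-1\}$; let $\tau:\mathbb{N}\to\Sigma^*$ send each token ID to its token. The extended tokenization function $F_{\text{tok}}$ maps a string $s\in\Sigma^*$ to the set of all its valid tokenizations, i.e. of all sequences $n_1\cdots n_k\in\mathbb{N}^*$ with $\tau(n_1)\cdots\tau(n_k)=s$. The extended tokenization language of $L$ is the set of all possible tokenizations of strings in $L$: $L'_E=\bigcup_{s\in L}F_{\text{tok}}(s)$. *)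

theory Defs
  imports "HOL-Library.Countable_Set"
begin

section \<open>Context-free languages\<close>

datatype ('n, 't) sym = Nt 'n | Tm 't

record ('n, 't) cfg =
  nonterminals :: "'n set"
  productions :: "('n \<times> ('n, 't) sym list) set"
  start :: 'n

definition cfg_over :: "'t set \<Rightarrow> ('n, 't) cfg \<Rightarrow> bool" where
  "cfg_over T G \<longleftrightarrow>
     finite T \<and> finite (nonterminals G) \<and> finite (productions G) \<and>
     start G \<in> nonterminals G \<and>
     productions G \<subseteq> nonterminals G \<times> lists (Nt ` nonterminals G \<union> Tm ` T)"

inductive derives1 :: "('n, 't) cfg \<Rightarrow> ('n, 't) sym list \<Rightarrow> ('n, 't) sym list \<Rightarrow> bool"
  for G where
  "(A, rhs) \<in> productions G \<Longrightarrow> derives1 G (u @ [Nt A] @ v) (u @ rhs @ v)"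

definition language :: "('n, 't) cfg \<Rightarrow> 't list set" where
  "language G = {w. (derives1 G)\<^sup>*\<^sup>* [Nt (start G)] (map Tm w)}"

text \<open>
  HOL cannot quantify existentially over the type of nonterminals, so natural numbers are used.
  As the set of nonterminals is finite, this loses no generality; see
  \<open>context_free_over_language\<close> below.
\<close>

definition context_free_over :: "'t set \<Rightarrow> 't list set \<Rightarrow> bool" where
  "context_free_over T L \<longleftrightarrow> (\<exists>G :: (nat, 't) cfg. cfg_over T G \<and> language G = L)"

definition rename_cfg :: "('n \<Rightarrow> 'm) \<Rightarrow> ('n, 't) cfg \<Rightarrow> ('m, 't) cfg" where
  "rename_cfg f G =
     \<lparr>nonterminals = f ` nonterminals G,
      productions = map_prod f (map (map_sym f id)) ` productions G,
      start = f (start G)\<rparr>"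

lemma derives1_rename:
  assumes "derives1 G x y"
  shows "derives1 (rename_cfg f G) (map (map_sym f id) x) (map (map_sym f id) y)"
  using assms
proof cases
  case (1 A rhs u v)
  have "(f A, map (map_sym f id) rhs) \<in> productions (rename_cfg f G)"
    using 1(3) by (force simp: rename_cfg_def)
  from derives1.intros[OF this] show ?thesis by (simp add: 1)
qed

lemma language_rename_subset: "language G \<subseteq> language (rename_cfg f G)"
proof
  fix w assume "w \<in> language G"
  then have "(derives1 G)\<^sup>*\<^sup>* [Nt (start G)] (map Tm w)" by (simp add: language_def)
  then have "(derives1 (rename_cfg f G))\<^sup>*\<^sup>*
      (map (map_sym f id) [Nt (start G)]) (map (map_sym f id) (map Tm w))"
  proof induction
    case base
    show ?case by (rule rtranclp.rtrancl_refl)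
  next
    case (step y z)
    show ?case
      by (rule rtranclp.rtrancl_into_rtrancl[OF step.IH derives1_rename[OF step.hyps(2)]])
  qed
  then show "w \<in> language (rename_cfg f G)"
    by (simp add: language_def rename_cfg_def comp_def)
qed

lemma rename_cfg_inverse:
  assumes G: "cfg_over T G" and gf: "\<And>A. A \<in> nonterminals G \<Longrightarrow> g (f A) = A"
  shows "rename_cfg g (rename_cfg f G) = (G :: ('n, 't) cfg)"
proof -
  have sym: "map_sym g id (map_sym f id s) = s" if "s \<in> Nt ` nonterminals G \<union> Tm ` T" for s
    using that gf by auto
  have "map_prod g (map (map_sym g id)) (map_prod f (map (map_sym f id)) p) = p"
    if p: "p \<in> productions G" for p
  proof -
    obtain A rhs where p': "p = (A, rhs)" by (cases p)
    have "A \<in> nonterminals G" "\<forall>s\<in>set rhs. s \<in> Nt ` nonterminals G \<union> Tm ` T"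
      using G p p' by (auto simp: cfg_over_def)
    then show ?thesis using sym gf by (simp add: p' map_idI)
  qed
  then have "productions (rename_cfg g (rename_cfg f G)) = productions G"
    by (simp add: rename_cfg_def image_image)
  moreover have "nonterminals (rename_cfg g (rename_cfg f G)) = nonterminals G"
    using gf by (simp add: rename_cfg_def image_image)
  moreover have "start (rename_cfg g (rename_cfg f G)) = start G"
    using gf G by (simp add: rename_cfg_def cfg_over_def)
  ultimately show ?thesis by simp
qed

theorem context_free_over_language:
  fixes G :: "('n, 't) cfg"
  assumes G: "cfg_over T G"
  shows "context_free_over T (language G)"
proof -
  define f where "f = to_nat_on (nonterminals G)"
  define g where "g = from_nat_into (nonterminals G)"
  have "countable (nonterminals G)"
    using G by (simp add: cfg_over_def countable_finite)
  then have gf: "g (f A) = A" if "A \<in> nonterminals G" for A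
    using that by (simp add: f_def g_def)
  have "language (rename_cfg f G) \<subseteq> language G"
    using language_rename_subset[of "rename_cfg f G" g] rename_cfg_inverse[of T G g f, OF G gf]
    by simp
  then have "language (rename_cfg f G) = language G"
    using language_rename_subset[of G f] by blast
  moreover have "cfg_over T (rename_cfg f G)"
    using G by (fastforce simp: cfg_over_def rename_cfg_def)
  ultimately show ?thesis
    unfolding context_free_over_def by blast
qed


section \<open>Tokenizers\<close>

text \<open>
  The empty string is allowed as a token, in which case a string may have infinitely many
  tokenizations.
\<close>

definition token_ids :: "'c list set \<Rightarrow> nat set" where
  "token_ids V = {..<card V}"

definition tokenizer :: "'c set \<Rightarrow> 'c list set \<Rightarrow> (nat \<Rightarrow> 'c list) \<Rightarrow> bool" where
  "tokenizer \<Sigma> V \<tau> \<longleftrightarrow>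
     finite \<Sigma> \<and> finite V \<and> V \<subseteq> lists \<Sigma> \<and> bij_betw \<tau> (token_ids V) V"

definition ext_tokenizations ::
  "'c list set \<Rightarrow> (nat \<Rightarrow> 'c list) \<Rightarrow> 'c list \<Rightarrow> nat list set" where
  "ext_tokenizations V \<tau> s = {ns \<in> lists (token_ids V). concat (map \<tau> ns) = s}"

definition ext_token_language ::
  "'c list set \<Rightarrow> (nat \<Rightarrow> 'c list) \<Rightarrow> 'c list set \<Rightarrow> nat list set" where
  "ext_token_language V \<tau> L = (\<Union>s\<in>L. ext_tokenizations V \<tau> s)"

end

theory Submission
  imports Defs "HOL-Library.Sublist"
begin

text \<open>
  The extended tokenization language is the inverse image of \<open>L\<close> under the monoid homomorphism
  induced by \<open>\<tau>\<close>, so this is closure of context-free languages under inverse homomorphisms.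
  Instead of going through pushdown automata, a grammar is built directly by a triple construction.
  A buffer is a suffix of some \<open>\<tau> n\<close>: the part of the last token that has been read but not yet
  been consumed. The nonterminal \<open>(p, s, q)\<close> derives only token sequences \<open>ns\<close> such that \<open>s\<close> derives
  some \<open>w\<close> with \<open>p \<cdot> \<tau>(ns) = w \<cdot> q\<close>, where a new token is read only when the buffer is empty. Empty
  tokens at the end of the sequence are never read in this way; the start symbol appends them.
\<close>

section \<open>Big-step derivations\<close>

text \<open>A forest of parse trees, one tree per symbol. The yield splits along the symbols, so
  inductions can follow the trees instead of the order of the rewriting steps.\<close>

inductive generates :: "('n, 't) cfg \<Rightarrow> ('n, 't) sym list \<Rightarrow> 't list \<Rightarrow> bool" for G where
  Nil: "generates G [] []"
| Tm: "generates G ss w \<Longrightarrow> generates G (Tm t # ss) (t # w)"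
| Nt: "(A, rhs) \<in> productions G \<Longrightarrow> generates G rhs u \<Longrightarrow> generates G ss w \<Longrightarrow>
    generates G (Nt A # ss) (u @ w)"

inductive_cases generates_TmE: "generates G (Tm t # ss) w"
inductive_cases generates_NtE: "generates G (Nt A # ss) w"

lemma generates_map_Tm: "generates G (map Tm w) w"
  by (induction w) (auto intro: generates.intros)

lemma generates_append:
  "generates G x u \<Longrightarrow> generates G y v \<Longrightarrow> generates G (x @ y) (u @ v)"
  by (induction rule: generates.induct) (auto intro: generates.intros)

lemma generates_appendE:
  assumes "generates G (x @ y) w"
  obtains u v where "w = u @ v" "generates G x u" "generates G y v"
proof -
  have "\<exists>u v. w = u @ v \<and> generates G x u \<and> generates G y v"
    using assms
  proof (induction x arbitrary: w)
    case Nil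
    then show ?case by (auto intro: generates.intros)
  next
    case (Cons s x)
    show ?case
    proof (cases s)
      case (Nt A)
      with Cons.prems obtain rhs a b where
        *: "w = a @ b" "(A, rhs) \<in> productions G" "generates G rhs a" "generates G (x @ y) b"
        by (auto elim: generates_NtE)
      from Cons.IH[OF *(4)] obtain u v where "b = u @ v" "generates G x u" "generates G y v"
        by blast
      with * Nt show ?thesis
        by (metis append.assoc generates.Nt)
    next
      case (Tm t)
      with Cons.prems obtain b where *: "w = t # b" "generates G (x @ y) b"
        by (auto elim: generates_TmE)
      from Cons.IH[OF *(2)] obtain u v where "b = u @ v" "generates G x u" "generates G y v"
        by blast
      with * Tm show ?thesis
        by (metis append_Cons generates.Tm)
    qed
  qed
  then show thesis using that by blast
qed

lemma derives1_context: "derives1 G x y \<Longrightarrow> derives1 G (a @ x @ b) (a @ y @ b)"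
proof (induction rule: derives1.induct)
  case (1 A rhs u v)
  then show ?case
    using derives1.intros[of A rhs G "a @ u" "v @ b"] by simp
qed

lemma derives_context:
  "(derives1 G)\<^sup>*\<^sup>* x y \<Longrightarrow> (derives1 G)\<^sup>*\<^sup>* (a @ x @ b) (a @ y @ b)"
  by (induction rule: rtranclp_induct)
    (auto intro: rtranclp.rtrancl_into_rtrancl derives1_context)

lemma derives_iff_generates:
  "(derives1 G)\<^sup>*\<^sup>* ss (map Tm w) \<longleftrightarrow> generates G ss w"
proof
  assume "(derives1 G)\<^sup>*\<^sup>* ss (map Tm w)"
  then show "generates G ss w"
  \<comment> \<open>Going backwards from the terminal word, each rewriting step gathers the trees
    over some \<open>rhs\<close> under a new root \<open>A\<close>.\<close>
  proof (induction rule: converse_rtranclp_induct)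
    case base
    show ?case by (rule generates_map_Tm)
  next
    case (step x y)
    from step.hyps(1) show ?case
    proof cases
      case (1 A rhs u v)
      with step.IH have "generates G (u @ rhs @ v) w" by simp
      then obtain a b c where "w = a @ b @ c" "generates G u a" "generates G rhs b"
        "generates G v c"
        by (elim generates_appendE) blast
      with 1 show ?thesis
        using generates_append[OF _ generates.Nt[OF 1(3)]] by simp
    qed
  qed
next
  assume "generates G ss w"
  then show "(derives1 G)\<^sup>*\<^sup>* ss (map Tm w)"
  proof induction
    case Nil
    show ?case by simp
  next
    case (Tm ss w t)
    then show ?case using derives_context[of G ss "map Tm w" "[Tm t]" "[]"] by simp
  next
    case (Nt A rhs u ss w)
    have "derives1 G (Nt A # ss) (rhs @ ss)"
      using derives1.intros[OF Nt.hyps(1), of "[]" ss] by simp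
    also have "(derives1 G)\<^sup>*\<^sup>* (rhs @ ss) (map Tm u @ ss)"
      using derives_context[OF Nt.IH(1), of "[]" ss] by simp
    also have "(derives1 G)\<^sup>*\<^sup>* (map Tm u @ ss) (map Tm u @ map Tm w)"
      using derives_context[OF Nt.IH(2), of "map Tm u" "[]"] by simp
    finally show ?case by simp
  qed
qed

corollary language_iff_generates: "w \<in> language G \<longleftrightarrow> generates G [Nt (start G)] w"
  by (simp add: language_def derives_iff_generates)

fun concat_of :: "('s \<Rightarrow> 't list \<Rightarrow> bool) \<Rightarrow> 's list \<Rightarrow> 't list \<Rightarrow> bool" where
  "concat_of P [] w \<longleftrightarrow> w = []"
| "concat_of P (s # ss) w \<longleftrightarrow> (\<exists>u v. w = u @ v \<and> P s u \<and> concat_of P ss v)"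

text \<open>Least fixed point principle: \<open>P\<close> interprets symbols by languages, and an
  interpretation closed under the productions contains everything that is generated.\<close>

lemma generates_sound:
  assumes "generates G ss w"
    and "\<And>t. P (Tm t) [t]"
    and "\<And>A rhs w. (A, rhs) \<in> productions G \<Longrightarrow> concat_of P rhs w \<Longrightarrow> P (Nt A) w"
  shows "concat_of P ss w"
  using assms(1)
proof induction
  case (Tm ss w t)
  then show ?case
    using assms(2) unfolding concat_of.simps by (intro exI[of _ "[t]"] exI[of _ w]) simp
next
  case (Nt A rhs u ss w)
  then show ?case
    using assms(3)[of A rhs u] unfolding concat_of.simps by blast
qed simp


section \<open>Inverse homomorphisms\<close>

text \<open>As in the Bar-Hillel construction for intersections with regular languages, all
  intermediate states are guessed. The final state is returned because the left-hand side of a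
  production has to name it. \<open>None\<close> is reserved for the new start symbol.\<close>

fun threads :: "'q set \<Rightarrow> 'q \<Rightarrow> 's list \<Rightarrow> ('q \<times> (('q \<times> 's \<times> 'q) option, 't) sym list) set" where
  "threads Q p [] = {(p, [])}"
| "threads Q p (s # ss) =
    (\<Union>r\<in>Q. map_prod id ((#) (Nt (Some (p, s, r)))) ` threads Q r ss)"

lemma finite_threads: "finite Q \<Longrightarrow> finite (threads Q p ss)"
  by (induction ss arbitrary: p) auto

lemma threads_closed:
  "(q, x) \<in> threads Q p ss \<Longrightarrow> p \<in> Q \<Longrightarrow>
    q \<in> Q \<and> set x \<subseteq> Nt ` Some ` (Q \<times> set ss \<times> Q)"
proof (induction ss arbitrary: p x)
  case (Cons s ss)
  then obtain r y where "r \<in> Q" "x = Nt (Some (p, s, r)) # y" "(q, y) \<in> threads Q r ss"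
    by auto
  with Cons.IH[of y r] Cons.prems(2) show ?case by auto
qed simp

locale inverse_hom =
  fixes \<Sigma> :: "'c set" and I :: "'a set" and h :: "'a \<Rightarrow> 'c list" and G :: "('n, 'c) cfg"
  assumes cfg: "cfg_over \<Sigma> G" and finite_I: "finite I" and h_lists: "h ` I \<subseteq> lists \<Sigma>"
begin

abbreviation hom :: "'a list \<Rightarrow> 'c list" where
  "hom ns \<equiv> concat (map h ns)"

text \<open>Inserting \<open>[]\<close> matters only for empty \<open>I\<close>: the start triple
  needs the empty buffer even then.\<close>

definition buffers :: "'c list set" where
  "buffers = (\<Union>t\<in>insert [] (h ` I). set (suffixes t))"

text \<open>A token is emitted when it is read, so \<open>consume\<close> emits nothing. After
  \<open>read\<close> the character \<open>c\<close> is still to be consumed: \<open>h n\<close> may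
  be empty, and then another token is read.\<close>

inductive_set inv_productions ::
  "(('c list \<times> ('n, 'c) sym \<times> 'c list) option \<times>
    (('c list \<times> ('n, 'c) sym \<times> 'c list) option, 'a) sym list) set" where
  consume: "c # q \<in> buffers \<Longrightarrow> (Some (c # q, Tm c, q), []) \<in> inv_productions"
| read: "c \<in> \<Sigma> \<Longrightarrow> q \<in> buffers \<Longrightarrow> n \<in> I \<Longrightarrow>
    (Some ([], Tm c, q), [Tm n, Nt (Some (h n, Tm c, q))]) \<in> inv_productions"
| thread: "(A, ss) \<in> productions G \<Longrightarrow> p \<in> buffers \<Longrightarrow> (q, x) \<in> threads buffers p ss \<Longrightarrow>
    (Some (p, Nt A, q), x) \<in> inv_productions"
| init: "(None, [Nt (Some ([], Nt (start G), []))]) \<in> inv_productions"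
| trail: "n \<in> I \<Longrightarrow> h n = [] \<Longrightarrow> (None, [Nt None, Tm n]) \<in> inv_productions"

definition inv_cfg :: "(('c list \<times> ('n, 'c) sym \<times> 'c list) option, 'a) cfg" where
  "inv_cfg =
    \<lparr>nonterminals =
      insert None (Some ` (buffers \<times> (Nt ` nonterminals G \<union> Tm ` \<Sigma>) \<times> buffers)),
     productions = inv_productions,
     start = None\<rparr>"

section \<open>Finiteness and well-formedness of the constructed grammar\<close>

lemma finite_buffers: "finite buffers"
  using finite_I by (auto simp: buffers_def)

lemma Nil_buffers: "[] \<in> buffers"
  by (simp add: buffers_def)

lemma h_buffers: "n \<in> I \<Longrightarrow> h n \<in> buffers"
  by (auto simp: buffers_def)

lemma buffers_ConsD: "c # q \<in> buffers \<Longrightarrow> q \<in> buffers"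
  by (auto simp: buffers_def dest: suffix_ConsD)

lemma buffers_lists: "q \<in> buffers \<Longrightarrow> set q \<subseteq> \<Sigma>"
  using h_lists set_mono_suffix by (fastforce simp: buffers_def)

lemma productions_inv_cfg: "productions inv_cfg = inv_productions"
  by (simp add: inv_cfg_def)

lemma finite_inv_productions: "finite inv_productions"
proof (rule finite_subset)
  show "inv_productions \<subseteq>
    (\<Union>c\<in>\<Sigma>. \<Union>q\<in>buffers. {(Some (c # q, Tm c, q), [])}) \<union>
    (\<Union>c\<in>\<Sigma>. \<Union>q\<in>buffers. \<Union>n\<in>I. {(Some ([], Tm c, q), [Tm n, Nt (Some (h n, Tm c, q))])}) \<union>
    (\<Union>(A, ss)\<in>productions G. \<Union>p\<in>buffers. \<Union>(q, x)\<in>threads buffers p ss.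
      {(Some (p, Nt A, q), x)}) \<union>
    {(None, [Nt (Some ([], Nt (start G), []))])} \<union>
    (\<Union>n\<in>I. {(None, [Nt None, Tm n])})" (is "_ \<subseteq> ?U")
  proof (rule subrelI)
    fix A x
    assume "(A, x) \<in> inv_productions"
    then show "(A, x) \<in> ?U"
    proof cases
      case (consume c q)
      \<comment> \<open>The rule \<open>consume\<close> bounds only \<open>c # q\<close>; buffers
        are words over \<Sigma> and closed under removing the first character.\<close>
      moreover have "c \<in> \<Sigma>" "q \<in> buffers"
        using consume buffers_ConsD buffers_lists by fastforce+
      ultimately show ?thesis by simp
    next
      case (thread B ss p q)
      show ?thesis
        by (rule UnI1, rule UnI1, rule UnI2, rule UN_I[OF thread(2)], unfold prod.case,
            rule UN_I[OF thread(3)], rule UN_I[OF thread(4)]) (simp add: thread(1))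
    qed simp_all
  qed
  show "finite ?U"
    using cfg finite_I finite_buffers by (auto simp: cfg_over_def finite_threads)
qed

lemma cfg_over_inv_cfg: "cfg_over I inv_cfg"
proof -
  have fin: "finite \<Sigma>" "finite (nonterminals G)" "finite (productions G)"
    and start: "start G \<in> nonterminals G"
    and prods: "\<And>A ss. (A, ss) \<in> productions G \<Longrightarrow>
      A \<in> nonterminals G \<and> set ss \<subseteq> Nt ` nonterminals G \<union> Tm ` \<Sigma>"
    using cfg by (auto simp: cfg_over_def)
  have "A \<in> nonterminals inv_cfg \<and>
      set x \<subseteq> Nt ` nonterminals inv_cfg \<union> Tm ` I" if Ax: "(A, x) \<in> inv_productions" for A x
    using Ax
  proof cases
    case (consume c q)
    then show ?thesis
      using buffers_ConsD[of c q] buffers_lists[of "c # q"] by (auto simp: inv_cfg_def)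
  next
    case (thread B ss p q)
    with threads_closed[OF thread(4,3)] prods[OF thread(2)] show ?thesis
      by (force simp: inv_cfg_def)
  qed (use start in \<open>auto simp: inv_cfg_def Nil_buffers h_buffers\<close>)
  then have "inv_productions \<subseteq>
      nonterminals inv_cfg \<times> lists (Nt ` nonterminals inv_cfg \<union> Tm ` I)"
    by (auto simp: lists_eq_set)
  then show ?thesis
    using fin finite_I finite_buffers finite_inv_productions
    by (simp add: cfg_over_def inv_cfg_def)
qed

section \<open>Soundness of the constructed grammar\<close>

fun meaning :: "(('c list \<times> ('n, 'c) sym \<times> 'c list) option, 'a) sym \<Rightarrow> 'a list \<Rightarrow> bool" where
  "meaning (Tm n) ns \<longleftrightarrow> ns = [n]"
| "meaning (Nt None) ns \<longleftrightarrow> set ns \<subseteq> I \<and> generates G [Nt (start G)] (hom ns)"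
| "meaning (Nt (Some (p, s, q))) ns \<longleftrightarrow>
    set ns \<subseteq> I \<and> (\<exists>w. generates G [s] w \<and> p @ hom ns = w @ q)"

text \<open>The equations telescope: the buffer left by one symbol is the one with which the next
  symbol starts.\<close>

lemma threads_sound:
  "(q, x) \<in> threads buffers p ss \<Longrightarrow> concat_of meaning x ns \<Longrightarrow>
    set ns \<subseteq> I \<and> (\<exists>w. generates G ss w \<and> p @ hom ns = w @ q)"
proof (induction ss arbitrary: p x ns)
  case Nil
  then show ?case by (auto intro: generates.Nil)
next
  case (Cons s ss)
  then obtain r y where x: "x = Nt (Some (p, s, r)) # y" and y: "(q, y) \<in> threads buffers r ss"
    by auto
  with Cons.prems(2) obtain a b w where
    ns: "ns = a @ b" and b: "concat_of meaning y b" and a: "set a \<subseteq> I"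
    and w: "generates G [s] w" "p @ hom a = w @ r"
    by auto
  from Cons.IH[OF y b] obtain v where
    v: "set b \<subseteq> I" "generates G ss v" "r @ hom b = v @ q"
    by blast
  have "p @ hom ns = (w @ v) @ q"
    using w(2) v(3) ns by (metis append.assoc concat_append map_append)
  then show ?case
    using generates_append[OF w(1) v(2)] ns a v(1) by auto
qed

text \<open>For \<open>read\<close>, moving \<open>h n\<close> from the buffer to the token sequence
  preserves the equation. For \<open>init\<close>, both buffers are empty, so the equation becomes
  \<open>hom ns = w\<close>. For \<open>trail\<close>, the appended token does not change
  \<open>hom\<close>.\<close>

lemma meaning_production:
  assumes "(A, x) \<in> inv_productions" and "concat_of meaning x ns"
  shows "meaning (Nt A) ns"
proof -
  from assms(1) show ?thesis
  proof cases
    case (consume c q)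
    then show ?thesis using assms(2) generates_map_Tm[of G "[c]"] by auto
  next
    case (thread B ss p q)
    from threads_sound[OF thread(4) assms(2)] obtain w where
      "set ns \<subseteq> I" "generates G ss w" "p @ hom ns = w @ q"
      by blast
    with thread(1) show ?thesis
      using generates.Nt[OF thread(2) _ generates.Nil] by fastforce
  qed (use assms(2) in auto)
qed

lemma inv_cfg_sound: "generates inv_cfg ss ns \<Longrightarrow> concat_of meaning ss ns"
  by (erule generates_sound) (auto simp: inv_cfg_def intro: meaning_production)

section \<open>Completeness of the constructed grammar\<close>

lemma Tm_complete:
  assumes "p \<in> buffers" and "set ns \<subseteq> I" and "p @ hom ns = c # v"
  shows "\<exists>ns1 ns2 r. ns = ns1 @ ns2 \<and> r \<in> buffers \<and> r @ hom ns2 = v \<and>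
    generates inv_cfg [Nt (Some (p, Tm c, r))] ns1"
  using assms
\<comment> \<open>A nonempty buffer must start with \<open>c\<close>, so no token is read. An empty
  one is replaced by \<open>h n\<close> for the next token \<open>n\<close>, which is why
  \<open>p\<close> varies. Tokens after the one supplying \<open>c\<close> stay in
  \<open>ns2\<close>.\<close>
proof (induction ns arbitrary: p)
  case Nil
  then have p: "p = c # v" by simp
  from generates.Nt[OF inv_productions.consume[folded productions_inv_cfg] generates.Nil generates.Nil] Nil.prems(1)
  have "generates inv_cfg [Nt (Some (p, Tm c, v))] []"
    by (simp add: p)
  moreover have "v \<in> buffers"
    using Nil.prems(1) buffers_ConsD p by blast
  ultimately show ?case by auto
next
  case (Cons n ns)
  show ?case
  proof (cases p)
    case (Cons d r)
    with Cons.prems(3) have p: "p = c # r" and v: "r @ hom (n # ns) = v"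
      by simp_all
    from generates.Nt[OF inv_productions.consume[folded productions_inv_cfg] generates.Nil generates.Nil] Cons.prems(1)
    have "generates inv_cfg [Nt (Some (p, Tm c, r))] []"
      by (simp add: p)
    moreover have "r \<in> buffers"
      using Cons.prems(1) buffers_ConsD p by blast
    ultimately show ?thesis
      using v by (intro exI[of _ "[]"] exI[of _ "n # ns"] exI[of _ r]) simp
  next
    case Nil
    \<comment> \<open>The production \<open>read\<close> exists only for characters of \<Sigma>;
      here \<open>c\<close> comes from a token in \<open>I\<close>.\<close>
    have "set (h m) \<subseteq> \<Sigma>" if "m \<in> I" for m
      using that h_lists by auto
    then have "set (hom (n # ns)) \<subseteq> \<Sigma>"
      using Cons.prems(2) unfolding set_concat set_map by blast
    moreover have eq: "hom (n # ns) = c # v"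
      using Cons.prems(3) Nil by simp
    ultimately have c: "c \<in> \<Sigma>"
      by (metis list.set_intros(1) subsetD)
    have n: "n \<in> I" "set ns \<subseteq> I"
      using Cons.prems(2) by simp_all
    from Cons.IH[OF h_buffers[OF n(1)] n(2)] eq obtain ns1 ns2 r where
      *: "ns = ns1 @ ns2" "r \<in> buffers" "r @ hom ns2 = v"
        "generates inv_cfg [Nt (Some (h n, Tm c, r))] ns1"
      by auto
    from generates.Nt[OF inv_productions.read[folded productions_inv_cfg, OF c *(2) n(1)] generates.Tm[OF *(4)] generates.Nil]
    show ?thesis
      using * Nil by (intro exI[of _ "n # ns1"] exI[of _ ns2] exI[of _ r]) simp
  qed
qed

text \<open>
  The remainder \<open>v\<close> is arbitrary, not only a buffer. This is what makes the induction go through: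
  the first symbol of a list is treated with everything generated by the other symbols in \<open>v\<close>.
\<close>

lemma threads_complete:
  assumes "generates G ss w" and "p \<in> buffers" and "set ns \<subseteq> I" and "p @ hom ns = w @ v"
  shows "\<exists>ns1 ns2 r x. ns = ns1 @ ns2 \<and> r \<in> buffers \<and> r @ hom ns2 = v \<and>
    (r, x) \<in> threads buffers p ss \<and> generates inv_cfg x ns1"
  using assms
proof (induction arbitrary: p ns v)
  case Nil
  then show ?case by (auto intro: generates.Nil)
next
  case (Tm ss w t)
  from Tm_complete[of p ns t "w @ v"] Tm.prems obtain ns1 ns2 r where
    1: "ns = ns1 @ ns2" "r \<in> buffers" "r @ hom ns2 = w @ v"
      "generates inv_cfg [Nt (Some (p, Tm t, r))] ns1"
    by auto
  with Tm.IH[of r ns2 v] Tm.prems(2) obtain ns3 ns4 q x where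
    2: "ns2 = ns3 @ ns4" "q \<in> buffers" "q @ hom ns4 = v" "(q, x) \<in> threads buffers r ss"
      "generates inv_cfg x ns3"
    by auto
  have "(q, Nt (Some (p, Tm t, r)) # x) \<in> threads buffers p (Tm t # ss)"
    using 1(2) 2(4) by force
  with generates_append[OF 1(4) 2(5)] show ?case
    using 1 2 by (intro exI[of _ "ns1 @ ns3"] exI[of _ ns4] exI[of _ q]) auto
next
  case (Nt A rhs u ss w)
  from Nt.IH(1)[of p ns "w @ v"] Nt.prems obtain ns1 ns2 r y where
    1: "ns = ns1 @ ns2" "r \<in> buffers" "r @ hom ns2 = w @ v" "(r, y) \<in> threads buffers p rhs"
      "generates inv_cfg y ns1"
    by auto
  with Nt.IH(2)[of r ns2 v] Nt.prems(2) obtain ns3 ns4 q x where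
    2: "ns2 = ns3 @ ns4" "q \<in> buffers" "q @ hom ns4 = v" "(q, x) \<in> threads buffers r ss"
      "generates inv_cfg x ns3"
    by auto
  from generates.Nt[OF inv_productions.thread[folded productions_inv_cfg, OF Nt.hyps(1) Nt.prems(1) 1(4)] 1(5) 2(5)]
  have "generates inv_cfg (Nt (Some (p, Nt A, r)) # x) (ns1 @ ns3)" .
  moreover have "(q, Nt (Some (p, Nt A, r)) # x) \<in> threads buffers p (Nt A # ss)"
    using 1(2) 2(4) by force
  ultimately show ?case
    using 1 2 by (intro exI[of _ "ns1 @ ns3"] exI[of _ ns4] exI[of _ q]) auto
qed

text \<open>All tokens in \<open>ms\<close> are empty. The rule \<open>trail\<close> adds one at the
  right end, so \<open>ms\<close> is moved over to \<open>ns\<close> from the left.\<close>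

lemma generates_None_append:
  assumes "generates inv_cfg [Nt None] ns" and "set ms \<subseteq> I" and "hom ms = []"
  shows "generates inv_cfg [Nt None] (ns @ ms)"
  using assms
proof (induction ms arbitrary: ns)
  case (Cons m ms)
  have "(None, [Nt None, Tm m]) \<in> productions inv_cfg"
    using Cons.prems by (simp add: productions_inv_cfg inv_productions.trail)
  from generates.Nt[OF this _ generates.Nil]
    generates_append[OF Cons.prems(1) generates_map_Tm[of _ "[m]"]]
  have "generates inv_cfg [Nt None] (ns @ [m])" by simp
  from Cons.IH[OF this] Cons.prems show ?case by simp
qed simp

lemma inv_cfg_complete:
  assumes "set ns \<subseteq> I" and "generates G [Nt (start G)] (hom ns)"
  shows "generates inv_cfg [Nt None] ns"
proof -
  \<comment> \<open>With remainder \<open>[]\<close>, both the last buffer and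
    \<open>hom ns2\<close> are empty: the unread tokens are exactly what \<open>trail\<close> can
    append.\<close>
  from threads_complete[OF assms(2) Nil_buffers assms(1), of "[]"] obtain ns1 ns2 x where
    *: "ns = ns1 @ ns2" "hom ns2 = []" "([], x) \<in> threads buffers [] [Nt (start G)]"
      "generates inv_cfg x ns1"
    by auto
  then have x: "x = [Nt (Some ([], Nt (start G), []))]"
    by auto
  have "(None, [Nt (Some ([], Nt (start G), []))]) \<in> productions inv_cfg"
    by (simp add: productions_inv_cfg inv_productions.init)
  from generates.Nt[OF this *(4)[unfolded x] generates.Nil]
  have "generates inv_cfg [Nt None] ns1" by simp
  with * assms(1) show ?thesis
    by (simp add: generates_None_append)
qed

theorem language_inv_cfg: "language inv_cfg = {ns \<in> lists I. hom ns \<in> language G}"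
proof -
  have "generates inv_cfg [Nt None] ns \<longleftrightarrow>
      set ns \<subseteq> I \<and> generates G [Nt (start G)] (hom ns)" for ns
    using inv_cfg_sound[of "[Nt None]" ns] inv_cfg_complete[of ns] by auto
  moreover have "start inv_cfg = None"
    by (simp add: inv_cfg_def)
  ultimately show ?thesis
    by (auto simp: language_iff_generates in_lists_conv_set)
qed

end

section \<open>Closure under inverse homomorphisms and its application to tokenizers\<close>

theorem context_free_over_inverse_hom:
  assumes "context_free_over \<Sigma> L" and "finite I" and "h ` I \<subseteq> lists \<Sigma>"
  shows "context_free_over I {ns \<in> lists I. concat (map h ns) \<in> L}"
proof -
  from assms(1) obtain G :: "(nat, 'a) cfg" where G: "cfg_over \<Sigma> G" "language G = L"
    by (auto simp: context_free_over_def)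
  interpret inverse_hom \<Sigma> I h G
    by unfold_locales (use G assms in auto)
  show ?thesis
    \<comment> \<open>The nonterminals of \<open>inv_cfg\<close> are optional triples; this renames
      them to natural numbers.\<close>
    using context_free_over_language[OF cfg_over_inv_cfg] by (simp add: language_inv_cfg G(2))
qed

theorem proposition3p3:
  fixes \<Sigma> :: "'c set" and V :: "'c list set" and \<tau> :: "nat \<Rightarrow> 'c list" and L :: "'c list set"
  assumes "tokenizer \<Sigma> V \<tau>"
    and "L \<subseteq> lists \<Sigma>"
    and "context_free_over \<Sigma> L"
  shows "context_free_over (token_ids V) (ext_token_language V \<tau> L)"
proof -
  have "\<tau> ` token_ids V \<subseteq> lists \<Sigma>"
    using assms(1) by (auto simp: tokenizer_def bij_betw_def)
  moreover have "ext_token_language V \<tau> L =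
      {ns \<in> lists (token_ids V). concat (map \<tau> ns) \<in> L}"
    by (auto simp: ext_token_language_def ext_tokenizations_def)
  ultimately show ?thesis
    using context_free_over_inverse_hom[OF assms(3), of "token_ids V" \<tau>] by (simp add: token_ids_def)
qed

end
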